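(* Let $A$ be the adjacency matrix of a Paley type strongly regular graph on $n$ vertices, and let $A'=J-I-A$. Then the incidence structure $(\mathcal{V}_A,\mathcal{B}_A\cup\mathcal{B}_{A'})$ is a $2$-$(n,\frac{n-1}{2},\frac{n-3}{2})$ design and a $3$-$(n,\frac{n-1}{2},\frac{n-9}{4})$ adesign.
   Context: $J$ denotes the all-one matrix and $I$ the identity matrix. A strongly regular graph with parameters $(n,k,\lambda,\mu)$ is a graph on $n$ vertices, regular of degree $k$, in which any two adjacent vertices have exactly $\lambda$ common neighbours and any two distinct non-adjacent vertices have exactly $\mu$ common neighbours. It is of Paley type if, up to complementation, its parameters are $(n,\frac{n-1}{2},\frac{n-5}{4},\frac{n-1}{4})$. For a $0$-$1$ matrix $M$ with rows and columns indexed by the vertex set, $\mathcal{V}_M$ denotes the set indexing the columns of $M$ and $\mathcal{B}_M$ the collection of supports of the rows of $M$ (one block per row); $\mathcal{B}_A\cup\mathcal{B}_{A'}$ is the collection of all these $2n$ blocks. An incidence structure $(V,\mathcal{B})$ is a point set $V$ with a collection $\mathcal{B}$ of subsets (blocks), incidence by membership. A $t$-$(v,k,\lambda)$ design has $|V|=v$, all blocks of size $k$, and every $t$-subset of $V$ in exactly $\lambda$ blocks. A $t$-$(v,k,\lambda)$ adesign has $|V|=v$, all blocks of size $k$, every $t$-subset of $V$ in either $\lambda$ or $\lambda+1$ blocks for a positive integer $\lambda$, and is not a $t$-design.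
   Formalization: The 3-adesign claim is stated only for n > 9, since an adesign needs a positive index: for n = 9 the index (n-9)/4 is 0, and for n = 5 it is -1 and no triple lies in any block. The 2-design claim is for all n. *)

theory Defs
  imports "HOL-Analysis.Analysis" "HOL-Library.Multiset"
begin

definition simple_graph :: "('v \<Rightarrow> 'v \<Rightarrow> bool) \<Rightarrow> bool" where
  "simple_graph E \<longleftrightarrow> symp E \<and> irreflp E"

definition complement_graph :: "('v \<Rightarrow> 'v \<Rightarrow> bool) \<Rightarrow> 'v \<Rightarrow> 'v \<Rightarrow> bool" where
  "complement_graph E x y \<longleftrightarrow> x \<noteq> y \<and> \<not> E x y"

definition strongly_regular ::
    "('v::finite \<Rightarrow> 'v \<Rightarrow> bool) \<Rightarrow> nat \<Rightarrow> nat \<Rightarrow> nat \<Rightarrow> nat \<Rightarrow> bool" where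
  "strongly_regular E n k l m \<longleftrightarrow>
     simple_graph E \<and> CARD('v) = n \<and>
     (\<forall>x. card {z. E x z} = k) \<and>
     (\<forall>x y. E x y \<longrightarrow> card {z. E x z \<and> E y z} = l) \<and>
     (\<forall>x y. x \<noteq> y \<and> \<not> E x y \<longrightarrow> card {z. E x z \<and> E y z} = m)"

text \<open>The parameters are natural numbers, so the equations below, read over the reals,
  also force \<open>n \<ge> 5\<close> and \<open>n mod 4 = 1\<close>.\<close>

definition paley_parameters :: "nat \<Rightarrow> nat \<Rightarrow> nat \<Rightarrow> nat \<Rightarrow> bool" where
  "paley_parameters n k l m \<longleftrightarrow>
     real k = (real n - 1) / 2 \<and> real l = (real n - 5) / 4 \<and> real m = (real n - 1) / 4"

definition paley_type :: "('v::finite \<Rightarrow> 'v \<Rightarrow> bool) \<Rightarrow> nat \<Rightarrow> bool" where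
  "paley_type E n \<longleftrightarrow> simple_graph E \<and>
     (\<exists>k l m. paley_parameters n k l m \<and>
        (strongly_regular E n k l m \<or> strongly_regular (complement_graph E) n k l m))"

lemma paley_type_mod_4:
  assumes "paley_type E n"
  shows "n \<ge> 5" and "n mod 4 = 1"
proof -
  obtain l where "real l = (real n - 5) / 4"
    using assms unfolding paley_type_def paley_parameters_def by blast
  then have "real n = real (4 * l + 5)" by (simp add: field_simps)
  then have "n = 4 * l + 5" by (simp only: of_nat_eq_iff)
  then show "n \<ge> 5" and "n mod 4 = 1" by presburger+
qed

definition adjacency_matrix :: "('v::finite \<Rightarrow> 'v \<Rightarrow> bool) \<Rightarrow> int ^ 'v ^ 'v" where
  "adjacency_matrix E = (\<chi> x y. if E x y then 1 else 0)"

definition all_one_matrix :: "int ^ 'c ^ 'r" where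
  "all_one_matrix = (\<chi> i j. 1)"

text \<open>Columns of a matrix are indexed by a type, so the point set does not depend on the entries.
  Blocks form a multiset, with one block for each row.\<close>

definition points_of :: "int ^ 'c ^ 'r \<Rightarrow> 'c set" where
  "points_of M = UNIV"

definition blocks_of :: "int ^ 'c ^ 'r::finite \<Rightarrow> 'c set multiset" where
  "blocks_of M = image_mset (\<lambda>i. {j. M $ i $ j \<noteq> 0}) (mset_set UNIV)"

definition incidence_structure :: "'p set \<Rightarrow> 'p set multiset \<Rightarrow> bool" where
  "incidence_structure V \<B> \<longleftrightarrow> finite V \<and> (\<forall>b \<in># \<B>. b \<subseteq> V)"

definition block_count :: "'p set multiset \<Rightarrow> 'p set \<Rightarrow> nat" where
  "block_count \<B> S = size {#b \<in># \<B>. S \<subseteq> b#}"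

definition design ::
    "nat \<Rightarrow> nat \<Rightarrow> nat \<Rightarrow> nat \<Rightarrow> 'p set \<Rightarrow> 'p set multiset \<Rightarrow> bool" where
  "design t v k l V \<B> \<longleftrightarrow>
     incidence_structure V \<B> \<and> card V = v \<and> (\<forall>b \<in># \<B>. card b = k) \<and>
     (\<forall>S \<subseteq> V. card S = t \<longrightarrow> block_count \<B> S = l)"

text \<open>The index \<open>l\<close> has to be positive: for \<open>l = (n - 9) / 4\<close> this means \<open>n > 9\<close>.
  For \<open>n = 5\<close> the claim would fail even without positivity, since no triple lies in a block.\<close>

definition adesign ::
    "nat \<Rightarrow> nat \<Rightarrow> nat \<Rightarrow> nat \<Rightarrow> 'p set \<Rightarrow> 'p set multiset \<Rightarrow> bool" where
  "adesign t v k l V \<B> \<longleftrightarrow>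
     incidence_structure V \<B> \<and> card V = v \<and> (\<forall>b \<in># \<B>. card b = k) \<and>
     0 < l \<and> (\<forall>S \<subseteq> V. card S = t \<longrightarrow> block_count \<B> S = l \<or> block_count \<B> S = l + 1) \<and>
     \<not> (\<exists>v' k' l'. design t v' k' l' V \<B>)"

end

(* For a triple of vertices spanning e edges, of which p pairs share a vertex, inclusion-exclusion
   gives that the number of blocks of both graphs containing it is (n - 9) / 4 + e - p. The value
   e - p is 0 for e = 0, 3 and 1 for e = 1, 2. An edge has common neighbours (so e = 3 occurs) and
   one end has a neighbour not adjacent to the other end (so e = 2 occurs), which rules out a
   3-design. *)

theory Submission
  imports Defs
begin

lemma complement_complement_graph:
  assumes "irreflp E"
  shows "complement_graph (complement_graph E) = E"
  using assms by (auto simp: complement_graph_def fun_eq_iff irreflp_def)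

definition neighbourhoods :: "('v::finite \<Rightarrow> 'v \<Rightarrow> bool) \<Rightarrow> 'v set multiset" where
  "neighbourhoods E = image_mset (\<lambda>x. {y. E x y}) (mset_set UNIV)"

lemma blocks_of_adjacency_matrix: "blocks_of (adjacency_matrix E) = neighbourhoods E"
  by (simp add: blocks_of_def adjacency_matrix_def neighbourhoods_def)

lemma all_one_minus_adjacency_matrix:
  assumes "irreflp E"
  shows "all_one_matrix - mat 1 - adjacency_matrix E = adjacency_matrix (complement_graph E)"
  using assms
  by (auto simp: vec_eq_iff all_one_matrix_def mat_def adjacency_matrix_def complement_graph_def
      irreflp_def)

lemma block_count_add: "block_count (\<A> + \<B>) S = block_count \<A> S + block_count \<B> S"
  by (simp add: block_count_def)

lemma block_count_neighbourhoods:
  fixes E :: "'v::finite \<Rightarrow> 'v \<Rightarrow> bool"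
  shows "block_count (neighbourhoods E) S = card {w. \<forall>x\<in>S. E w x}"
proof -
  have "filter_mset (\<lambda>b. S \<subseteq> b) (neighbourhoods E)
      = image_mset (\<lambda>x. {y. E x y}) (mset_set {w. S \<subseteq> {y. E w y}})"
    by (simp add: neighbourhoods_def filter_mset_image_mset)
  then show ?thesis
    by (simp add: block_count_def subset_eq)
qed

text \<open>The Paley parameters expressed through \<open>l\<close>, the number of common neighbours
  of adjacent vertices: \<open>n = 4 * l + 5\<close>, degree \<open>2 * l + 2\<close>, and
  \<open>l + 1\<close> for non-adjacent vertices. No division remains.\<close>

locale paley_graph =
  fixes E :: "'v::finite \<Rightarrow> 'v \<Rightarrow> bool" and l :: nat
  assumes srg: "strongly_regular E (4 * l + 5) (2 * l + 2) l (l + 1)"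
begin

lemma sym: "E x y \<longleftrightarrow> E y x"
  using srg by (auto simp: strongly_regular_def simple_graph_def symp_def)

lemma irrefl: "\<not> E x x"
  using srg by (auto simp: strongly_regular_def simple_graph_def irreflp_def)

lemma card_vertices: "CARD('v) = 4 * l + 5"
  using srg by (simp add: strongly_regular_def)

lemma degree: "card {z. E x z} = 2 * l + 2"
  using srg by (simp add: strongly_regular_def)

text \<open>Integer-valued indicators turn the counting of common neighbours into polynomial
  identities under sums, with honest subtraction.\<close>

abbreviation a :: "'v \<Rightarrow> 'v \<Rightarrow> int" where
  "a x y \<equiv> of_bool (E x y)"

abbreviation c :: "'v \<Rightarrow> 'v \<Rightarrow> int" where
  "c x y \<equiv> of_bool (complement_graph E x y)"

lemma sum_a: "(\<Sum>w\<in>UNIV. a x w) = 2 * int l + 2"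
  using degree[of x] by simp

text \<open>The counts \<open>l\<close> (adjacent) and \<open>l + 1\<close> (non-adjacent) differ by
  one, so a single formula linear in \<open>a x y\<close> covers both.\<close>

lemma sum_a_a:
  assumes "x \<noteq> y"
  shows "(\<Sum>w\<in>UNIV. a x w * a y w) = int l + 1 - a x y"
proof -
  have "(\<Sum>w\<in>UNIV. a x w * a y w) = int (card {w. E x w \<and> E y w})"
    by (simp flip: of_bool_conj)
  then show ?thesis
    using srg assms by (auto simp: strongly_regular_def)
qed

lemma sum_c_c:
  assumes "x \<noteq> y"
  shows "(\<Sum>w\<in>UNIV. c x w * c y w) = int l + a x y"
proof -
  \<comment> \<open>This expands \<open>(1 - a x w) * (1 - a y w)\<close>. It agrees with
    \<open>c x w * c y w\<close> except at \<open>w = x\<close> and \<open>w = y\<close>, where the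
    left side vanishes; the two \<open>if\<close> terms correct this.\<close>
  have "(\<Sum>w\<in>UNIV. c x w * c y w) = (\<Sum>w\<in>UNIV. 1 - a x w - a y w + a x w * a y w
      - (if x = w then 1 - a y w else 0) - (if y = w then 1 - a x w else 0))"
    using assms by (intro sum.cong) (auto simp: complement_graph_def irrefl)
  also have "\<dots> = int l + a x y"
    by (simp only: sum.distrib sum_subtractf sum_a sum_a_a[OF assms])
      (simp add: card_vertices sym[of y x] del: sum_of_bool_eq)
  finally show ?thesis .
qed

text \<open>The number of common neighbours of three vertices is not fixed by the parameters, so it
  stays as a sum on the right, with sign \<open>-1\<close> from the cubic term of the
  expansion.\<close>

lemma sum_c_c_c:
  assumes "x \<noteq> y" "x \<noteq> z" "y \<noteq> z"
  shows "(\<Sum>w\<in>UNIV. c x w * c y w * c z w) =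
    int l - 1 + a x y + a x z + a y z - a x y * a x z - a x y * a y z - a x z * a y z
      - (\<Sum>w\<in>UNIV. a x w * a y w * a z w)"
proof -
  have "(\<Sum>w\<in>UNIV. c x w * c y w * c z w) =
      (\<Sum>w\<in>UNIV. 1 - a x w - a y w - a z w + a x w * a y w + a x w * a z w + a y w * a z w
        - a x w * a y w * a z w
        - (if x = w then (1 - a y w) * (1 - a z w) else 0)
        - (if y = w then (1 - a x w) * (1 - a z w) else 0)
        - (if z = w then (1 - a x w) * (1 - a y w) else 0))"
    using assms by (intro sum.cong) (auto simp: complement_graph_def irrefl)
  \<comment> \<open>Vertices, degrees and pairs are evaluated; the last three products are the
    corrections at \<open>w = x\<close>, \<open>w = y\<close> and \<open>w = z\<close>.\<close>
  also have "\<dots> = int (4 * l + 5) - 3 * (2 * int l + 2)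
      + (int l + 1 - a x y) + (int l + 1 - a x z) + (int l + 1 - a y z)
      - (\<Sum>w\<in>UNIV. a x w * a y w * a z w)
      - (1 - a y x) * (1 - a z x) - (1 - a x y) * (1 - a z y) - (1 - a x z) * (1 - a y z)"
    by (simp only: sum.distrib sum_subtractf sum_a sum_a_a assms not_False_eq_True)
      (simp add: card_vertices del: sum_of_bool_eq)
  finally show ?thesis
    by (simp add: sym[of y x] sym[of z x] sym[of z y] algebra_simps del: sum_of_bool_eq)
qed

abbreviation blocks :: "'v set multiset" where
  "blocks \<equiv> neighbourhoods E + neighbourhoods (complement_graph E)"

text \<open>The terms \<open>- a x y\<close> from the graph and \<open>+ a x y\<close> from its
  complement cancel.\<close>

lemma block_count_blocks_pair:
  assumes "x \<noteq> y"
  shows "block_count blocks {x, y} = 2 * l + 1"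
proof -
  have "int (block_count blocks {x, y})
      = (\<Sum>w\<in>UNIV. a x w * a y w) + (\<Sum>w\<in>UNIV. c x w * c y w)"
    by (simp add: block_count_add block_count_neighbourhoods complement_graph_def sym[of _ x]
        sym[of _ y] eq_commute flip: of_bool_conj)
  then show ?thesis
    using sum_a_a[OF assms] sum_c_c[OF assms] by linarith
qed

text \<open>The undetermined triple sum cancels between the graph and its complement, leaving only
  the edges inside the triple.\<close>

lemma block_count_blocks_triple:
  assumes "x \<noteq> y" "x \<noteq> z" "y \<noteq> z"
  shows "int (block_count blocks {x, y, z}) =
    int l - 1 + (a x y + a x z + a y z - a x y * a x z - a x y * a y z - a x z * a y z)"
proof -
  have "int (block_count blocks {x, y, z})
      = (\<Sum>w\<in>UNIV. a x w * a y w * a z w) + (\<Sum>w\<in>UNIV. c x w * c y w * c z w)"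
    by (simp add: block_count_add block_count_neighbourhoods complement_graph_def sym[of _ x]
        sym[of _ y] sym[of _ z] eq_commute conj_assoc flip: of_bool_conj)
  then show ?thesis
    using sum_c_c_c[OF assms] by linarith
qed

text \<open>The complement has the same degree:
  \<open>(4 * l + 5) - 1 - (2 * l + 2) = 2 * l + 2\<close>.\<close>

lemma card_block:
  assumes "b \<in># blocks"
  shows "card b = 2 * l + 2"
proof -
  have "{y. complement_graph E x y} = UNIV - insert x {y. E x y}" for x
    by (auto simp: complement_graph_def)
  then have "card {y. complement_graph E x y} = 2 * l + 2" for x
    using card_vertices degree[of x] irrefl[of x]
    by (simp add: card_Diff_subset)
  then show ?thesis
    using assms degree by (auto simp: neighbourhoods_def)
qed

lemma design_blocks: "design 2 (4 * l + 5) (2 * l + 2) (2 * l + 1) UNIV blocks"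
  using card_block block_count_blocks_pair
  by (auto simp: design_def incidence_structure_def card_vertices card_2_iff)

text \<open>The bound \<open>2 \<le> l\<close> expresses \<open>n > 9\<close>; it makes the index
  \<open>l - 1\<close> positive and its natural subtraction exact.\<close>

lemma adesign_blocks:
  assumes "2 \<le> l"
  shows "adesign 3 (4 * l + 5) (2 * l + 2) (l - 1) UNIV blocks"
proof -
  have index: "block_count blocks S = l - 1 \<or> block_count blocks S = l" if card: "card S = 3" for S
  proof -
    obtain x y z where S: "S = {x, y, z}" and "x \<noteq> y" "x \<noteq> z" "y \<noteq> z"
      using card by (auto simp: card_3_iff)
    then show ?thesis
      using block_count_blocks_triple[of x y z] assms
      by (auto simp: of_bool_def split: if_splits)
  qed
  have no_design: "\<not> design 3 v k m UNIV blocks" for v k m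
  proof
    assume design: "design 3 v k m UNIV blocks"
    have m: "int m = int l - 1
        + (a x y + a x z + a y z - a x y * a x z - a x y * a y z - a x z * a y z)"
      if "x \<noteq> y" "x \<noteq> z" "y \<noteq> z" for x y z
    proof -
      have "card {x, y, z} = 3" using that by simp
      then have "block_count blocks {x, y, z} = m"
        using design unfolding design_def by blast
      then show ?thesis
        using block_count_blocks_triple[OF that] by simp
    qed
    fix x :: 'v
    obtain y where xy: "E x y"
      using degree[of x] by (metis Collect_empty_eq card.empty add_eq_0_iff_both_eq_0 zero_neq_numeral)
    have common: "card {z. E x z \<and> E y z} = l"
      using srg xy by (simp add: strongly_regular_def)
    then obtain z where z: "E x z" "E y z"
      using assms by (metis (mono_tags, lifting) Collect_empty_eq card.empty not_numeral_le_zero)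
    \<comment> \<open>The right-hand set has only \<open>l + 1\<close> elements, fewer than the
      \<open>2 * l + 2\<close> neighbours of \<open>x\<close>.\<close>
    have "\<not> {w. E x w} \<subseteq> insert y {z. E x z \<and> E y z}"
    proof
      assume "{w. E x w} \<subseteq> insert y {z. E x z \<and> E y z}"
      then have "card {w. E x w} \<le> card (insert y {z. E x z \<and> E y z})"
        by (intro card_mono) auto
      then show False
        by (simp add: degree card_insert_if common irrefl)
    qed
    then obtain w where w: "E x w" "w \<noteq> y" "\<not> E y w"
      by auto
    \<comment> \<open>The triangle \<open>x\<close>, \<open>y\<close>, \<open>z\<close> contributes
      \<open>3 - 3 = 0\<close>, whereas the path through \<open>x\<close> with ends \<open>y\<close>
      and \<open>w\<close> contributes \<open>2 - 1 = 1\<close>.\<close>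
    have "int m = int l - 1"
      using m[of x y z] xy z irrefl by (auto simp: of_bool_def)
    moreover have "int m = int l"
      using m[of x y w] xy w irrefl by (auto simp: of_bool_def)
    ultimately show False by simp
  qed
  show ?thesis
    using assms card_block index no_design
    by (auto simp: adesign_def incidence_structure_def card_vertices)
qed

end

theorem theorem1:
  fixes E :: "'v::finite \<Rightarrow> 'v \<Rightarrow> bool"
    and A A' :: "int ^ 'v ^ 'v"
    and n :: nat
  assumes "paley_type E n"
    and "A = adjacency_matrix E"
    and "A' = all_one_matrix - mat 1 - A"
  shows "design 2 n ((n - 1) div 2) ((n - 3) div 2)
           (points_of A) (blocks_of A + blocks_of A')
       \<and> (n > 9 \<longrightarrow> adesign 3 n ((n - 1) div 2) ((n - 9) div 4)
           (points_of A) (blocks_of A + blocks_of A'))"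
proof -
  obtain k l m where params: "paley_parameters n k l m"
    and srg: "strongly_regular E n k l m \<or> strongly_regular (complement_graph E) n k l m"
    and irrefl: "irreflp E"
    using assms(1) by (auto simp: paley_type_def simple_graph_def)
  have "real n = real (4 * l + 5)" "real k = real (2 * l + 2)" "real m = real (l + 1)"
    using params by (auto simp: paley_parameters_def field_simps)
  then have n: "n = 4 * l + 5" and k: "k = 2 * l + 2" and m: "m = l + 1"
    by (simp_all only: of_nat_eq_iff)
  have "blocks_of A + blocks_of A' = neighbourhoods E + neighbourhoods (complement_graph E)"
    by (simp add: assms all_one_minus_adjacency_matrix irrefl blocks_of_adjacency_matrix)
  \<comment> \<open>\<open>F\<close> is whichever of \<open>E\<close> and its complement has the
    given parameters. Swapping the two only exchanges the summands of the block multiset.\<close>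
  then obtain F where F: "paley_graph F l"
    and blocks: "blocks_of A + blocks_of A' = neighbourhoods F + neighbourhoods (complement_graph F)"
    using srg complement_complement_graph[OF irrefl]
    unfolding n k m by (metis add.commute paley_graph.intro)
  have index: "(n - 1) div 2 = 2 * l + 2" "(n - 3) div 2 = 2 * l + 1" "(n - 9) div 4 = l - 1"
    using n by presburger+
  show ?thesis
    using paley_graph.design_blocks[OF F] paley_graph.adesign_blocks[OF F]
    unfolding index blocks points_of_def by (simp add: n)
qed

end
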